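(* Let $(X,\rho)$ be a complete metric space with $|X|\geq 3$, let $\lambda\in[0,\tfrac12)$, and let $T:X\to CB(X)$ be a multivalued $\lambda$-contracting perimeters of triangles mapping on $X$, i.e. $$H(Tx,Ty)+H(Ty,Tz)+H(Tx,Tz)\leq \lambda\left(\rho(x,y)+\rho(y,z)+\rho(x,z)\right)$$ for all three pairwise distinct points $x,y,z\in X$. If $T$ has the property of forming a triangle, then $T$ has a fixed point, i.e. there exists $x\in X$ with $x\in Tx$.
   Context: For a metric space $(X,\rho)$, $CB(X)$ denotes the class of all nonempty closed and bounded subsets of $X$, and $H$ is the Pompeiu–Hausdorff metric on $CB(X)$ induced by $\rho$: $H(A,B)=\max\{\sup_{a\in A}\rho(a,B),\ \sup_{b\in B}\rho(b,A)\}$, where $\rho(a,B)=\inf_{b\in B}\rho(a,b)$. A multivalued mapping $T:X\to CB(X)$ has the property of forming a triangle if for all $x\in X$, all $y\in Tx$ with $x\neq y$, and all $\alpha>0$, there exists $z\in Ty$ with $H(Tx,Tz)>0$ such that $\rho(y,z)\leq H(Tx,Ty)+\alpha$. *)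

theory Defs
  imports "HOL-Analysis.Analysis"
begin

definition CB :: "'a::metric_space set set" where
  "CB = {A. A \<noteq> {} \<and> closed A \<and> bounded A}"

text \<open>
  For arguments in \<^const>\<open>CB\<close> both suprema range over nonempty sets of reals that are bounded
  above, and \<^const>\<open>infdist\<close> is a genuine infimum. Outside \<^const>\<open>CB\<close> the value is unspecified
  or a default value and carries no meaning.
\<close>

definition hausdorff_dist :: "'a::metric_space set \<Rightarrow> 'a set \<Rightarrow> real" where
  "hausdorff_dist A B = max (SUP a\<in>A. infdist a B) (SUP b\<in>B. infdist b A)"

text \<open>The range of the constant \<open>c\<close> is deliberately not part of the following definition.\<close>

definition contracting_perimeters :: "real \<Rightarrow> ('a::metric_space \<Rightarrow> 'a set) \<Rightarrow> bool" where
  "contracting_perimeters c T \<longleftrightarrow>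
    (\<forall>x y z. x \<noteq> y \<longrightarrow> y \<noteq> z \<longrightarrow> x \<noteq> z \<longrightarrow>
      hausdorff_dist (T x) (T y) + hausdorff_dist (T y) (T z) + hausdorff_dist (T x) (T z)
        \<le> c * (dist x y + dist y z + dist x z))"

definition forms_triangle :: "('a::metric_space \<Rightarrow> 'a set) \<Rightarrow> bool" where
  "forms_triangle T \<longleftrightarrow>
    (\<forall>x. \<forall>y\<in>T x. x \<noteq> y \<longrightarrow> (\<forall>\<alpha>>0. \<exists>z\<in>T y.
      hausdorff_dist (T x) (T z) > 0 \<and> dist y z \<le> hausdorff_dist (T x) (T y) + \<alpha>))"

end

theory Submission
  imports Defs
begin

text \<open>
  In the absence of fixed points the triangle property yields a sequence with
  \<open>x (n + 1) \<in> T (x n)\<close> whose triples of consecutive points are pairwise distinct.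
  The third side of such a triple is at most the sum of the other two, so the sums
  \<open>s n\<close> of two consecutive steps satisfy \<open>s (n + 1) \<le> 2c s n + 2q\<^sup>n\<close> with an error
  chosen so that \<open>2c < q < 1\<close>. Hence \<open>x\<close> converges geometrically to some \<open>p\<close>. Infinitely often
  \<open>x n\<close>, \<open>x (n + 1)\<close>, \<open>p\<close> are pairwise distinct, and then the contraction condition
  bounds the distance from \<open>x (n + 1)\<close> to \<open>T p\<close>, so \<open>p \<in> T p\<close>.
\<close>

text \<open>This makes the real suprema in \<open>hausdorff_dist\<close> genuine upper bounds on
  \<open>CB\<close>.\<close>

lemma bdd_above_infdist_image:
  fixes A B :: "'a::metric_space set"
  assumes "bounded A" "B \<noteq> {}"
  shows "bdd_above ((\<lambda>a. infdist a B) ` A)"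
proof -
  obtain b where b: "b \<in> B" using assms(2) by blast
  obtain e where e: "\<And>a. a \<in> A \<Longrightarrow> dist b a \<le> e"
    using assms(1) bounded_any_center[of A b] by blast
  have "infdist a B \<le> e" if "a \<in> A" for a
    using infdist_le[OF b, of a] e[OF that] by (simp add: dist_commute)
  then show ?thesis by (auto intro!: bdd_aboveI)
qed

lemma infdist_le_hausdorff_dist:
  assumes "A \<in> CB" "B \<in> CB" "a \<in> A"
  shows "infdist a B \<le> hausdorff_dist A B"
proof -
  have "infdist a B \<le> (SUP a\<in>A. infdist a B)"
    using assms by (intro cSUP_upper bdd_above_infdist_image) (auto simp: CB_def)
  then show ?thesis by (simp add: hausdorff_dist_def)
qed

lemma hausdorff_dist_nonneg:
  assumes "A \<in> CB" "B \<in> CB"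
  shows "0 \<le> hausdorff_dist A B"
proof -
  obtain a where "a \<in> A" using assms(1) by (auto simp: CB_def)
  then show ?thesis
    using infdist_le_hausdorff_dist[OF assms] infdist_nonneg[of a B] by fastforce
qed

lemma hausdorff_dist_self:
  assumes "A \<in> CB"
  shows "hausdorff_dist A A = 0"
  using assms by (simp add: hausdorff_dist_def CB_def)

text \<open>Distances are bounded by partial geometric sums, kept in closed form so that the
  induction closes exactly; all are below the tail \<open>C * q ^ n / (1 - q)\<close>, which tends
  to 0.\<close>

lemma Cauchy_geometric_steps:
  fixes x :: "nat \<Rightarrow> 'a::metric_space"
  assumes q: "0 \<le> q" "q < 1" and step: "\<And>n. dist (x n) (x (Suc n)) \<le> C * q ^ n"
  shows "Cauchy x"
proof -
  have C: "0 \<le> C" using order_trans[OF zero_le_dist step[of 0]] by simp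
  have tele: "dist (x n) (x (n + m)) \<le> C * (q ^ n - q ^ (n + m)) / (1 - q)" for n m
  proof (induction m)
    case (Suc m)
    have "dist (x n) (x (n + Suc m)) \<le> C * (q ^ n - q ^ (n + m)) / (1 - q) + C * q ^ (n + m)"
      using dist_triangle[of "x n" "x (Suc (n + m))" "x (n + m)"] Suc step[of "n + m"] by simp
    also have "\<dots> = C * (q ^ n - q ^ (n + Suc m)) / (1 - q)"
      using q by (simp add: field_simps)
    finally show ?case .
  qed simp
  have "(\<lambda>n. C * q ^ n / (1 - q)) \<longlonglongrightarrow> C * 0 / (1 - q)"
    using q by (intro tendsto_intros LIMSEQ_realpow_zero) auto
  then have lim: "(\<lambda>n. C * q ^ n / (1 - q)) \<longlonglongrightarrow> 0" by simp
  show ?thesis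
    unfolding Cauchy_altdef2
  proof (intro allI impI)
    fix e :: real assume "0 < e"
    with lim obtain N where N: "C * q ^ N / (1 - q) < e"
      by (metis (no_types, lifting) order_tendstoD(2) eventually_sequentially order_refl)
    have "dist (x n) (x N) < e" if "N \<le> n" for n
    proof -
      have "dist (x N) (x n) \<le> C * (q ^ N - q ^ n) / (1 - q)"
        using tele[of N "n - N"] that by simp
      also have "\<dots> \<le> C * q ^ N / (1 - q)"
        using q C by (intro divide_right_mono mult_left_mono) auto
      finally show ?thesis using N by (simp add: dist_commute)
    qed
    then show "\<exists>N. \<forall>n\<ge>N. dist (x n) (x N) < e" by blast
  qed
qed

theorem theorem4:
  fixes T :: "'a::complete_space \<Rightarrow> 'a set" and c :: real
  assumes "infinite (UNIV :: 'a set) \<or> 3 \<le> card (UNIV :: 'a set)"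
    and "0 \<le> c" and "c < 1 / 2"
    and "\<And>x. T x \<in> CB"
    and "contracting_perimeters c T"
    and "forms_triangle T"
  shows "\<exists>x. x \<in> T x"
proof (rule ccontr)
  assume nofix: "\<not> (\<exists>x. x \<in> T x)"
  note CBT = assms(4)
  \<comment> \<open>The midpoint of \<open>2 * c\<close> and 1, positive even for
    \<open>c = 0\<close>, so each \<open>q ^ n\<close> may serve as \<alpha> in the triangle
    property.\<close>
  define q where "q = (1 + 2 * c) / 2"
  have q: "0 < q" "q < 1" "2 * c < q" using assms(2,3) by (auto simp: q_def)
  \<comment> \<open>The triangle property picks the next point from the last two, so the recursion
    runs on pairs of consecutive points.\<close>
  let ?Q = "\<lambda>n u v. fst v = snd u \<and> hausdorff_dist (T (fst u)) (T (snd v)) > 0 \<and>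
      dist (snd u) (snd v) \<le> hausdorff_dist (T (fst u)) (T (snd u)) + q ^ n"
  have "\<exists>f. \<forall>n. snd (f n) \<in> T (fst (f n)) \<and> ?Q n (f n) (f (Suc n))"
  proof (rule dependent_nat_choice[where P = "\<lambda>n u. snd u \<in> T (fst u)"])
    obtain a b where "b \<in> T a" using CBT by (fastforce simp: CB_def)
    then show "\<exists>u. snd u \<in> T (fst u)" by force
  next
    fix u :: "'a \<times> 'a" and n
    assume u: "snd u \<in> T (fst u)"
    then have "fst u \<noteq> snd u" using nofix by metis
    then obtain z where "z \<in> T (snd u)" "hausdorff_dist (T (fst u)) (T z) > 0"
        "dist (snd u) z \<le> hausdorff_dist (T (fst u)) (T (snd u)) + q ^ n"
      using assms(6) u q(1) unfolding forms_triangle_def by (meson zero_less_power)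
    then show "\<exists>v. snd v \<in> T (fst v) \<and> ?Q n u v"
      by (intro exI[of _ "(snd u, z)"]) simp
  qed
  then obtain f where f: "\<And>n. snd (f n) \<in> T (fst (f n))" "\<And>n. ?Q n (f n) (f (Suc n))"
    by blast
  define x where "x n = fst (f n)" for n
  define H where "H u v = hausdorff_dist (T u) (T v)" for u v
  have Suc_x: "x (Suc n) = snd (f n)" for n using f(2)[of n] by (simp add: x_def)
  have xT: "x (Suc n) \<in> T (x n)" for n using f(1)[of n] by (simp add: Suc_x) (simp add: x_def)
  have Hpos: "H (x n) (x (Suc (Suc n))) > 0" for n
    using f(2)[of n] by (simp add: Suc_x H_def) (simp add: x_def)
  have step: "dist (x (Suc n)) (x (Suc (Suc n))) \<le> H (x n) (x (Suc n)) + q ^ n" for n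
    using f(2)[of n] by (simp add: Suc_x H_def) (simp add: x_def)
  have H0: "0 \<le> H u v" for u v using CBT by (simp add: H_def hausdorff_dist_nonneg)
  have ne1: "x n \<noteq> x (Suc n)" for n using xT[of n] nofix by metis
  \<comment> \<open>Equality would make the positive distance in \<open>Hpos\<close> a distance from
    a set to itself.\<close>
  have ne2: "x n \<noteq> x (Suc (Suc n))" for n
    using Hpos[of n] hausdorff_dist_self[OF CBT] by (auto simp: H_def)
  have contr: "H u v + H v w + H u w \<le> c * (dist u v + dist v w + dist u w)"
    if "u \<noteq> v" "v \<noteq> w" "u \<noteq> w" for u v w
    using assms(5) that by (auto simp: contracting_perimeters_def H_def)
  define s where "s n = dist (x n) (x (Suc n)) + dist (x (Suc n)) (x (Suc (Suc n)))" for n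
  \<comment> \<open>Add \<open>step\<close> at \<open>n\<close> and \<open>Suc n\<close>, then bound
    the two distances between images by \<open>contr\<close>, dropping its third.\<close>
  have s_Suc: "s (Suc n) \<le> 2 * c * s n + 2 * q ^ n" for n
  proof -
    have "c * (s n + dist (x n) (x (Suc (Suc n)))) \<le> c * (2 * s n)"
      using assms(2) dist_triangle[of "x n" "x (Suc (Suc n))" "x (Suc n)"]
      by (intro mult_left_mono) (auto simp: s_def)
    moreover have "q ^ Suc n \<le> q ^ n" using q by (simp add: mult_left_le_one_le)
    ultimately show ?thesis
      using contr[OF ne1 ne1 ne2, of n] H0[of "x n" "x (Suc (Suc n))"] step[of n] step[of "Suc n"]
      by (simp add: s_def algebra_simps)
  qed
  \<comment> \<open>The two entries serve the base case and the induction step of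
    \<open>s_le\<close>; the latter needs \<open>2 * c * C + 2 \<le> C * q\<close>.\<close>
  define C where "C = max (s 0) (2 / (q - 2 * c))"
  have C: "s 0 \<le> C" "2 / (q - 2 * c) \<le> C" by (simp_all add: C_def)
  have "2 \<le> C * (q - 2 * c)" using C(2) q(3) by (simp add: pos_divide_le_eq)
  then have Cq: "2 * c * C + 2 \<le> C * q" by (simp add: algebra_simps)
  have s_le: "s n \<le> C * q ^ n" for n
  proof (induction n)
    case (Suc n)
    have "s (Suc n) \<le> 2 * c * (C * q ^ n) + 2 * q ^ n"
      using s_Suc[of n] mult_left_mono[OF Suc, of "2 * c"] assms(2) by linarith
    also have "\<dots> = (2 * c * C + 2) * q ^ n" by (simp add: algebra_simps)
    also have "\<dots> \<le> C * q * q ^ n" using Cq q(1) by (intro mult_right_mono) auto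
    finally show ?case by (simp add: mult.assoc)
  qed (use C(1) in simp)
  have "dist (x n) (x (Suc n)) \<le> C * q ^ n" for n
    using s_le[of n] zero_le_dist[of "x (Suc n)" "x (Suc (Suc n))"] unfolding s_def by linarith
  then have "Cauchy x" using q by (intro Cauchy_geometric_steps[of q x C]) auto
  then obtain p where p: "x \<longlonglongrightarrow> p" using Cauchy_convergent convergentD by blast
  have "infdist p (T p) \<le> e" if "0 < e" for e
  proof -
    have "0 < e / 3" using that by simp
    then obtain N where N: "\<And>n. n \<ge> N \<Longrightarrow> dist (x n) p < e / 3"
      using p by (meson metric_LIMSEQ_D)
    \<comment> \<open>By \<open>ne1\<close> and \<open>ne2\<close>, a term equal to \<open>p\<close>
      is followed by two terms different from \<open>p\<close>.\<close>
    obtain n where n: "n \<ge> N" "x n \<noteq> p" "x (Suc n) \<noteq> p"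
    proof (cases "x (Suc N) = p")
      case True
      then show thesis using that[of "Suc (Suc N)"] ne1[of "Suc N"] ne2[of "Suc N"] by simp
    next
      case False
      then show thesis
        using that[of N] that[of "Suc N"] ne2[of N] by (cases "x N = p") auto
    qed
    let ?d = "dist (x n) p" and ?d' = "dist (x (Suc n)) p"
    have tri: "dist (x n) (x (Suc n)) \<le> ?d + ?d'" by (simp add: dist_triangle2)
    have "infdist (x (Suc n)) (T p) \<le> H (x n) p"
      unfolding H_def by (intro infdist_le_hausdorff_dist CBT xT)
    also have "\<dots> \<le> c * (dist (x n) (x (Suc n)) + ?d' + ?d)"
      using contr[OF ne1 n(3) n(2)] H0[of "x n" "x (Suc n)"] H0[of "x (Suc n)" p] by linarith
    \<comment> \<open>With \<open>c \<le> 1 / 2\<close> the bound is \<open>?d + ?d'\<close>; moving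
      from \<open>x (Suc n)\<close> to \<open>p\<close> costs another \<open>?d'\<close>, three
      terms below \<open>e / 3\<close> in all.\<close>
    also have "\<dots> \<le> (1 / 2) * (2 * (?d + ?d'))"
      using assms(2,3) tri by (intro mult_mono) auto
    finally have "infdist (x (Suc n)) (T p) \<le> ?d + ?d'" by simp
    moreover have "infdist p (T p) \<le> infdist (x (Suc n)) (T p) + ?d'"
      using infdist_triangle[of p "T p" "x (Suc n)"] by (simp add: dist_commute)
    ultimately show ?thesis using N[of n] N[of "Suc n"] n(1) by simp
  qed
  then have "infdist p (T p) = 0"
    using infdist_nonneg[of p "T p"] field_le_epsilon[of "infdist p (T p)" 0] by simp
  then have "p \<in> T p" using CBT[of p] by (simp add: CB_def in_closed_iff_infdist_zero)
  then show False using nofix by blast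
qed

end
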